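(* Let $\mathbb{K}$ be $\mathbb{R}$ or $\mathbb{C}$, let $p\ge q\ge 1$ be fixed integers, and let $M\in\mathbb{K}^{q\times p}$ be a fixed matrix of full rank $q$ (so $M$ is invertible if $p=q$, and surjective if $p>q$). For $n\ge 1$ let $\operatorname{TM}_{\langle n\rangle,p,q}:\mathbb{K}^{n\times n\times p}\times\mathbb{K}^{n\times n\times p}\to\mathbb{K}^{n\times n\times p}$, $(\mathcal{A},\mathcal{B})\mapsto \mathcal{A}*_M\mathcal{B}$, be the tensor-tensor multiplication with $M$, and let $\operatorname{M}_{\langle n\rangle}:\mathbb{K}^{n\times n}\times\mathbb{K}^{n\times n}\to\mathbb{K}^{n\times n}$, $(A,B)\mapsto AB$, be matrix multiplication. Then $$\omega(\operatorname{TM}_{\langle n\rangle,p,q})=\omega(\operatorname{M}_{\langle n\rangle}),$$ where $\omega$ denotes the asymptotic exponent on the tensor rank.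
   Context: Mode-3 product: for $\mathcal{A}=[a_{ijk}]\in\mathbb{K}^{m\times n\times p}$ and $N=[n_{kl}]\in\mathbb{K}^{r\times p}$, $\mathcal{A}\times_3 N\in\mathbb{K}^{m\times n\times r}$ has entries $(\mathcal{A}\times_3 N)_{ijk}=\sum_{l=1}^p n_{kl}a_{ijl}$. The $i$-th frontal slice $\mathcal{A}^{(i)}$ of $\mathcal{A}\in\mathbb{K}^{m\times n\times p}$ is the $m\times n$ matrix with entries $a_{\cdot\,\cdot\, i}$. Face-wise product: $(\mathcal{A}\triangle\mathcal{B})^{(i)}=\mathcal{A}^{(i)}\mathcal{B}^{(i)}$ for all $i$. Tensor-tensor multiplication: for $M\in\mathbb{K}^{q\times p}$ of full rank $q\le p$, $\mathcal{A}*_M\mathcal{B}=((\mathcal{A}\times_3 M)\triangle(\mathcal{B}\times_3 M))\times_3 M^+$, where $M^+=M^H(MM^H)^{-1}$ is the Moore-Penrose inverse ($M^+=M^{-1}$ if $p=q$). This map is bilinear over $\mathbb{K}$. Tensor rank: for a bilinear map $T:U\times V\to W$ of finite-dimensional $\mathbb{K}$-vector spaces, $\mathbf{R}(T)$ is the least $r$ such that $T(u,v)=\sum_{i=1}^r\alpha_i(u)\beta_i(v)w_i$ for some $\alpha_i\in U^*$, $\beta_i\in V^*$, $w_i\in W$. For a sequence $(T_n)$ of bilinear maps, the asymptotic exponent on the tensor rank is $\omega(T_n)=\inf\{\tau\mid \mathbf{R}(T_n)=O(n^\tau)\}$. *)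

theory Defs
  imports
    "Jordan_Normal_Form.Schur_Decomposition"
    "Jordan_Normal_Form.DL_Rank"
    "HOL-Library.Landau_Symbols"
    "HOL-Library.Extended_Real"
begin

section \<open>Third-order tensors\<close>

text \<open>A tensor of format \<open>m \<times> n \<times> p\<close> is stored as the vector of its \<open>p\<close> frontal slices, each an
  \<open>m \<times> n\<close> matrix. Indices start at 0: the entry \<open>a\<^sub>i\<^sub>j\<^sub>k\<close> of \<open>A\<close> is \<open>A $ k $$ (i, j)\<close>, and the
  \<open>k\<close>-th frontal slice is \<open>A $ k\<close>.\<close>

type_synonym 'a tensor3 = "'a mat vec"

definition carrier_tensor3 :: "nat \<Rightarrow> nat \<Rightarrow> nat \<Rightarrow> 'a tensor3 set" where
  "carrier_tensor3 m n p = {A. dim_vec A = p \<and> (\<forall>k<p. A $ k \<in> carrier_mat m n)}"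

text \<open>The ring multiplication and unit are fields of the record type \<open>module\<close> that play no role
  in a vector space.\<close>

definition tensor3_space ::
  "'a :: field itself \<Rightarrow> nat \<Rightarrow> nat \<Rightarrow> nat \<Rightarrow> ('a, 'a tensor3) module" where
  "tensor3_space ty m n p = \<lparr>
     carrier = carrier_tensor3 m n p,
     monoid.mult = undefined,
     one = undefined,
     zero = vec p (\<lambda>k. 0\<^sub>m m n),
     add = (\<lambda>A B. vec p (\<lambda>k. A $ k + B $ k)),
     module.smult = (\<lambda>c A. vec p (\<lambda>k. c \<cdot>\<^sub>m (A $ k)))\<rparr>"

text \<open>Since a tensor with no slices does not determine \<open>m\<close> and \<open>n\<close>, the format of the slices
  is passed explicitly.\<close>

definition mode3_prod :: "nat \<Rightarrow> nat \<Rightarrow> 'a :: field tensor3 \<Rightarrow> 'a mat \<Rightarrow> 'a tensor3" where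
  "mode3_prod m n A N =
     vec (dim_row N) (\<lambda>k. mat m n (\<lambda>(i, j). \<Sum>l<dim_col N. N $$ (k, l) * A $ l $$ (i, j)))"

definition facewise_prod :: "'a :: field tensor3 \<Rightarrow> 'a tensor3 \<Rightarrow> 'a tensor3" where
  "facewise_prod A B = vec (dim_vec A) (\<lambda>k. A $ k * B $ k)"

text \<open>The Moore-Penrose inverse \<open>M\<^sup>H (M M\<^sup>H)\<^sup>-\<^sup>1\<close> of a matrix of full row rank. Over the reals
  \<^const>\<open>conjugate\<close> is the identity, so \<^const>\<open>mat_adjoint\<close> is the transpose there. If
  \<open>M M\<^sup>H\<close> is not invertible, the value is unspecified.\<close>

definition pinv :: "'a :: conjugatable_field mat \<Rightarrow> 'a mat" where
  "pinv M = mat_adjoint M * the (mat_inverse (M * mat_adjoint M))"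

text \<open>The product \<open>A *\<^sub>M B\<close> of an \<open>m \<times> s \<times> p\<close> tensor \<open>A\<close> and an \<open>s \<times> n \<times> p\<close> tensor \<open>B\<close>.\<close>

definition tensor_mult ::
  "nat \<Rightarrow> nat \<Rightarrow> nat \<Rightarrow> 'a :: conjugatable_field mat \<Rightarrow> 'a tensor3 \<Rightarrow> 'a tensor3 \<Rightarrow> 'a tensor3" where
  "tensor_mult m s n M A B =
     mode3_prod m n (facewise_prod (mode3_prod m s A M) (mode3_prod s n B M)) (pinv M)"


section \<open>Tensor rank and its asymptotic exponent\<close>

definition scalar_space :: "'a :: field itself \<Rightarrow> ('a, 'a) module" where
  "scalar_space ty = \<lparr>carrier = UNIV, monoid.mult = (*), one = 1, zero = 0, add = (+), module.smult = (*)\<rparr>"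

definition dual_space :: "('a :: field, 'u) module \<Rightarrow> ('u \<Rightarrow> 'a) set" where
  "dual_space U = LinearCombinations.module_hom class_ring U (scalar_space TYPE('a))"

definition tensor_rank ::
  "('a :: field, 'u) module \<Rightarrow> ('a, 'v) module \<Rightarrow> ('a, 'w) module \<Rightarrow> ('u \<Rightarrow> 'v \<Rightarrow> 'w) \<Rightarrow> nat" where
  "tensor_rank U V W T = (LEAST r. \<exists>\<alpha> \<beta> w.
     (\<forall>i<r. \<alpha> i \<in> dual_space U \<and> \<beta> i \<in> dual_space V \<and> w i \<in> carrier W) \<and>
     (\<forall>u\<in>carrier U. \<forall>v\<in>carrier V.
        T u v = (\<Oplus>\<^bsub>W\<^esub>i\<in>{..<r}. (\<alpha> i u * \<beta> i v) \<odot>\<^bsub>W\<^esub> w i)))"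

text \<open>The infimum is taken in the extended reals, so that it is meaningful even if the set of
  admissible \<open>\<tau>\<close> is empty or unbounded below.\<close>

definition rank_exponent ::
  "(nat \<Rightarrow> ('a :: field, 'u) module) \<Rightarrow> (nat \<Rightarrow> ('a, 'v) module) \<Rightarrow> (nat \<Rightarrow> ('a, 'w) module) \<Rightarrow>
   (nat \<Rightarrow> 'u \<Rightarrow> 'v \<Rightarrow> 'w) \<Rightarrow> ereal" where
  "rank_exponent U V W T = Inf {ereal \<tau> | \<tau>.
     (\<lambda>n. real (tensor_rank (U n) (V n) (W n) (T n))) \<in> O(\<lambda>n. real n powr \<tau>)}"


section \<open>Basic facts\<close>

lemma tensor3_space_vectorspace:
  "vectorspace class_ring (tensor3_space TYPE('a :: field) m n p)"
proof -
  let ?V = "tensor3_space TYPE('a) m n p"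
  have inv: "\<exists>B\<in>carrier ?V. B \<oplus>\<^bsub>?V\<^esub> A = \<zero>\<^bsub>?V\<^esub>" if "A \<in> carrier ?V" for A
    using that
    by (intro bexI[of _ "vec p (\<lambda>k. - (A $ k))"])
      (auto simp: tensor3_space_def carrier_tensor3_def)
  have ag: "abelian_group ?V"
    by (rule abelian_groupI[OF _ _ _ _ _ inv],
        auto simp: tensor3_space_def carrier_tensor3_def
          intro!: eq_vecI intro: assoc_add_mat[of _ m n])
      (auto simp: comm_add_mat[of _ m n])
  have "Module.module class_ring ?V"
    by (rule Module.module.intro[OF class_cring.is_cring ag], unfold_locales)
      (auto simp: tensor3_space_def carrier_tensor3_def add_smult_distrib_left_mat[of _ m n]
          add_smult_distrib_right_mat[of _ m n] intro!: eq_vecI)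
  then show ?thesis
    by (simp add: vectorspace_def class_field)
qed

lemma scalar_space_vectorspace: "vectorspace class_ring (scalar_space TYPE('a :: field))"
proof -
  have inv: "\<exists>y\<in>carrier (scalar_space TYPE('a)).
      y \<oplus>\<^bsub>scalar_space TYPE('a)\<^esub> x = \<zero>\<^bsub>scalar_space TYPE('a)\<^esub>" for x
    by (rule bexI[of _ "- x"]) (auto simp: scalar_space_def)
  have ag: "abelian_group (scalar_space TYPE('a))"
    by (rule abelian_groupI[OF _ _ _ _ _ inv]) (auto simp: scalar_space_def)
  have "Module.module class_ring (scalar_space TYPE('a))"
    by (rule Module.module.intro[OF class_cring.is_cring ag], unfold_locales)
      (auto simp: scalar_space_def algebra_simps)
  then show ?thesis
    by (simp add: vectorspace_def class_field)
qed

lemma tensor_mult_carrier: "tensor_mult m s n M A B \<in> carrier_tensor3 m n (dim_col M)"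
  by (simp add: tensor_mult_def mode3_prod_def carrier_tensor3_def pinv_def mat_adjoint_def)

end

theory Submission
  imports Defs
begin

text \<open>With \<open>f\<^sub>k A\<close> the \<open>k\<close>-th frontal slice of \<open>A \<times>\<^sub>3 M\<close> and \<open>h\<^sub>k C\<close> the mode-3 product with
  \<open>M\<^sup>+\<close> of the tensor whose only nonzero slice is \<open>C\<close> at position \<open>k\<close>, the tensor product is
  \<open>\<Sum>\<^sub>k h\<^sub>k (f\<^sub>k A \<cdot> f\<^sub>k B)\<close>, a sum of \<open>q\<close> linear images of the matrix product. Conversely, since
  \<open>M M\<^sup>+ = 1\<close> makes \<open>f\<^sub>k \<circ> h\<^sub>l\<close> the identity for \<open>k = l\<close> and zero otherwise, the matrix product is
  \<open>f\<^sub>0 (h\<^sub>0 A *\<^sub>M h\<^sub>0 B)\<close>. Hence the two ranks differ by a factor between \<open>1\<close> and \<open>q\<close>.\<close>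

section \<open>Linear maps and finite sums in vector spaces\<close>

lemma linear_finsum:
  fixes U :: "('a :: field, 'u) module" and W :: "('a, 'w) module"
  assumes U: "vectorspace class_ring U" and W: "vectorspace class_ring W"
    and f: "f \<in> LinearCombinations.module_hom class_ring U W"
    and g: "g \<in> I \<rightarrow> carrier U"
  shows "f (\<Oplus>\<^bsub>U\<^esub>i\<in>I. g i) = (\<Oplus>\<^bsub>W\<^esub>i\<in>I. f (g i))"
proof -
  interpret U: vectorspace class_ring U by (rule U)
  interpret W: vectorspace class_ring W by (rule W)
  interpret mod_hom class_ring U W f
    using f by unfold_locales
  show ?thesis
    using g
  proof (induct I rule: infinite_finite_induct)
    case (insert a A)
    have 1: "(\<Oplus>\<^bsub>W\<^esub>i\<in>insert a A. f (g i)) = f (g a) \<oplus>\<^bsub>W\<^esub> (\<Oplus>\<^bsub>W\<^esub>i\<in>A. f (g i))"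
      using insert by (intro W.finsum_insert) (auto intro!: f_im)
    have 2: "(\<Oplus>\<^bsub>U\<^esub>i\<in>insert a A. g i) = g a \<oplus>\<^bsub>U\<^esub> (\<Oplus>\<^bsub>U\<^esub>i\<in>A. g i)"
      using insert by (intro U.finsum_insert) auto
    show ?case
      unfolding 1 2 using insert by (subst f_add) (auto intro!: U.finsum_closed)
  \<comment> \<open>Remaining are the empty and the infinite index set. By convention
    \<open>finsum\<close> is zero over an infinite set, and \<open>f\<close> preserves zero.\<close>
  qed auto
qed

lemma linear_comp:
  assumes "f \<in> LinearCombinations.module_hom R U V" and "g \<in> LinearCombinations.module_hom R V W"
  shows "(\<lambda>u. g (f u)) \<in> LinearCombinations.module_hom R U W"
  using assms unfolding LinearCombinations.module_hom_def Pi_def by auto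


section \<open>Rank decompositions\<close>

text \<open>The predicate under \<open>LEAST\<close> in \<open>tensor_rank\<close>, named so that
  decompositions of a given, not necessarily minimal, length can be built and combined.\<close>

definition has_rank_decomp ::
  "('a :: field, 'u) module \<Rightarrow> ('a, 'v) module \<Rightarrow> ('a, 'w) module \<Rightarrow> ('u \<Rightarrow> 'v \<Rightarrow> 'w) \<Rightarrow> nat \<Rightarrow> bool"
  where "has_rank_decomp U V W T r \<longleftrightarrow> (\<exists>\<alpha> \<beta> w.
     (\<forall>i<r. \<alpha> i \<in> dual_space U \<and> \<beta> i \<in> dual_space V \<and> w i \<in> carrier W) \<and>
     (\<forall>u\<in>carrier U. \<forall>v\<in>carrier V.
        T u v = (\<Oplus>\<^bsub>W\<^esub>i\<in>{..<r}. (\<alpha> i u * \<beta> i v) \<odot>\<^bsub>W\<^esub> w i)))"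

lemma tensor_rank_eq_Least: "tensor_rank U V W T = (LEAST r. has_rank_decomp U V W T r)"
  by (simp add: tensor_rank_def has_rank_decomp_def)

lemma tensor_rank_le: "has_rank_decomp U V W T r \<Longrightarrow> tensor_rank U V W T \<le> r"
  unfolding tensor_rank_eq_Least by (rule Least_le)

text \<open>The least length is attained only if some decomposition exists. Existence is therefore
  established for both products before their ranks are compared.\<close>

lemma has_rank_decomp_tensor_rank:
  "has_rank_decomp U V W T r \<Longrightarrow> has_rank_decomp U V W T (tensor_rank U V W T)"
  unfolding tensor_rank_eq_Least by (rule LeastI)

lemma has_rank_decomp_cong:
  assumes "has_rank_decomp U V W T r"
    and "\<And>u v. u \<in> carrier U \<Longrightarrow> v \<in> carrier V \<Longrightarrow> T' u v = T u v"
  shows "has_rank_decomp U V W T' r"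
  using assms by (simp add: has_rank_decomp_def)

text \<open>A decomposition itself places the values in \<open>W\<close>, as sums of scaled vectors.
  Splitting a term off a \<open>finsum\<close> of such maps requires this membership.\<close>

lemma has_rank_decomp_closed:
  fixes W :: "('a :: field, 'w) module"
  assumes W: "vectorspace class_ring W" and T: "has_rank_decomp U V W T r"
    and uv: "u \<in> carrier U" "v \<in> carrier V"
  shows "T u v \<in> carrier W"
proof -
  interpret W: vectorspace class_ring W by (rule W)
  show ?thesis
    using T uv unfolding has_rank_decomp_def
    by (auto intro!: W.finsum_closed W.smult_closed simp: class_ring_simps)
qed

lemma has_rank_decomp_simple:
  fixes W :: "('a :: field, 'w) module"
  assumes W: "vectorspace class_ring W"
    and "\<alpha> \<in> dual_space U" "\<beta> \<in> dual_space V" "w \<in> carrier W"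
  shows "has_rank_decomp U V W (\<lambda>u v. (\<alpha> u * \<beta> v) \<odot>\<^bsub>W\<^esub> w) 1"
proof -
  interpret W: vectorspace class_ring W by (rule W)
  have "(\<Oplus>\<^bsub>W\<^esub>i\<in>{..<Suc 0}. c \<odot>\<^bsub>W\<^esub> w) = c \<odot>\<^bsub>W\<^esub> w" for c
    using assms(4) by (simp add: lessThan_Suc class_ring_simps)
  then show ?thesis
    unfolding has_rank_decomp_def
    using assms(2-4) by (intro exI[of _ "\<lambda>_. \<alpha>"] exI[of _ "\<lambda>_. \<beta>"] exI[of _ "\<lambda>_. w"]) simp
qed

lemma has_rank_decomp_zero:
  fixes W :: "('a :: field, 'w) module"
  assumes "vectorspace class_ring W"
  shows "has_rank_decomp U V W (\<lambda>u v. \<zero>\<^bsub>W\<^esub>) 0"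
proof -
  interpret W: vectorspace class_ring W by (rule assms)
  show ?thesis by (simp add: has_rank_decomp_def)
qed

lemma has_rank_decomp_add:
  fixes W :: "('a :: field, 'w) module"
  assumes W: "vectorspace class_ring W"
    and T: "has_rank_decomp U V W T r" and T': "has_rank_decomp U V W T' r'"
  shows "has_rank_decomp U V W (\<lambda>u v. T u v \<oplus>\<^bsub>W\<^esub> T' u v) (r + r')"
proof -
  interpret W: vectorspace class_ring W by (rule W)
  obtain \<alpha> \<beta> w where d: "\<forall>i<r. \<alpha> i \<in> dual_space U \<and> \<beta> i \<in> dual_space V \<and> w i \<in> carrier W"
    and e: "\<forall>u\<in>carrier U. \<forall>v\<in>carrier V. T u v = (\<Oplus>\<^bsub>W\<^esub>i\<in>{..<r}. (\<alpha> i u * \<beta> i v) \<odot>\<^bsub>W\<^esub> w i)"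
    using T unfolding has_rank_decomp_def by blast
  obtain \<alpha>' \<beta>' w' where d': "\<forall>i<r'. \<alpha>' i \<in> dual_space U \<and> \<beta>' i \<in> dual_space V \<and> w' i \<in> carrier W"
    and e': "\<forall>u\<in>carrier U. \<forall>v\<in>carrier V. T' u v = (\<Oplus>\<^bsub>W\<^esub>i\<in>{..<r'}. (\<alpha>' i u * \<beta>' i v) \<odot>\<^bsub>W\<^esub> w' i)"
    using T' unfolding has_rank_decomp_def by blast
  \<comment> \<open>Concatenation: the first \<open>r\<close> indices carry the terms of
    \<open>T\<close>, the next \<open>r'\<close> indices those of \<open>T'\<close>, shifted by
    \<open>r\<close>.\<close>
  define a where "a i = (if i < r then \<alpha> i else \<alpha>' (i - r))" for i
  define b where "b i = (if i < r then \<beta> i else \<beta>' (i - r))" for i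
  define c where "c i = (if i < r then w i else w' (i - r))" for i
  have c: "c i \<in> carrier W" if "i < r + r'" for i
    using that d d' by (auto simp: c_def)
  have "T u v \<oplus>\<^bsub>W\<^esub> T' u v = (\<Oplus>\<^bsub>W\<^esub>i\<in>{..<r + r'}. (a i u * b i v) \<odot>\<^bsub>W\<^esub> c i)"
    if u: "u \<in> carrier U" and v: "v \<in> carrier V" for u v
  proof -
    have split: "{..<r + r'} = {..<r} \<union> (\<lambda>i. i + r) ` {..<r'}"
    proof -
      have "i \<in> (\<lambda>i. i + r) ` {..<r'}" if "i < r + r'" "\<not> i < r" for i
        using that by (intro image_eqI[of _ _ "i - r"]) auto
      then show ?thesis by auto
    qed
    have "(\<Oplus>\<^bsub>W\<^esub>i\<in>{..<r + r'}. (a i u * b i v) \<odot>\<^bsub>W\<^esub> c i)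
        = (\<Oplus>\<^bsub>W\<^esub>i\<in>{..<r}. (a i u * b i v) \<odot>\<^bsub>W\<^esub> c i)
          \<oplus>\<^bsub>W\<^esub> (\<Oplus>\<^bsub>W\<^esub>i\<in>(\<lambda>i. i + r) ` {..<r'}. (a i u * b i v) \<odot>\<^bsub>W\<^esub> c i)"
      unfolding split
      by (rule W.finsum_Un_disjoint) (auto intro!: c W.smult_closed simp: class_ring_simps)
    also have "(\<Oplus>\<^bsub>W\<^esub>i\<in>(\<lambda>i. i + r) ` {..<r'}. (a i u * b i v) \<odot>\<^bsub>W\<^esub> c i)
        = (\<Oplus>\<^bsub>W\<^esub>i\<in>{..<r'}. (a (i + r) u * b (i + r) v) \<odot>\<^bsub>W\<^esub> c (i + r))"
      by (rule W.finsum_reindex) (auto intro!: c W.smult_closed simp: class_ring_simps)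
    also have "\<dots> = T' u v"
      using u v e' d' by (simp add: a_def b_def c_def)
    also have "(\<Oplus>\<^bsub>W\<^esub>i\<in>{..<r}. (a i u * b i v) \<odot>\<^bsub>W\<^esub> c i)
        = (\<Oplus>\<^bsub>W\<^esub>i\<in>{..<r}. (\<alpha> i u * \<beta> i v) \<odot>\<^bsub>W\<^esub> w i)"
      using d by (intro W.finsum_cong') (auto simp: a_def b_def c_def class_ring_simps intro!: W.smult_closed)
    also have "\<dots> = T u v"
      using u v e by simp
    finally show ?thesis ..
  qed
  then show ?thesis
    unfolding has_rank_decomp_def using d d'
    by (intro exI[of _ a] exI[of _ b] exI[of _ c]) (auto simp: a_def b_def c_def)
qed

lemma has_rank_decomp_finsum:
  fixes W :: "('a :: field, 'w) module" and m :: nat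
  assumes W: "vectorspace class_ring W"
    and "\<And>k. k < m \<Longrightarrow> has_rank_decomp U V W (T k) r"
  shows "has_rank_decomp U V W (\<lambda>u v. \<Oplus>\<^bsub>W\<^esub>k\<in>{..<m}. T k u v) (m * r)"
  using assms(2)
proof (induct m)
  case 0
  interpret W: vectorspace class_ring W by (rule W)
  show ?case using has_rank_decomp_zero[OF W] by simp
next
  case (Suc m)
  interpret W: vectorspace class_ring W by (rule W)
  have "has_rank_decomp U V W (\<lambda>u v. T m u v \<oplus>\<^bsub>W\<^esub> (\<Oplus>\<^bsub>W\<^esub>k\<in>{..<m}. T k u v)) (r + m * r)"
    using Suc by (intro has_rank_decomp_add[OF W]) auto
  then show ?case
    unfolding mult_Suc
  proof (rule has_rank_decomp_cong)
    fix u v assume uv: "u \<in> carrier U" "v \<in> carrier V"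
    show "(\<Oplus>\<^bsub>W\<^esub>k\<in>{..<Suc m}. T k u v) = T m u v \<oplus>\<^bsub>W\<^esub> (\<Oplus>\<^bsub>W\<^esub>k\<in>{..<m}. T k u v)"
      unfolding lessThan_Suc
      by (rule W.finsum_insert) (auto intro!: has_rank_decomp_closed[OF W Suc.prems uv])
  qed
qed

text \<open>Functionals are pulled back along \<open>f\<close> and \<open>g\<close>, and vectors are
  pushed forward along \<open>h\<close>, so the number of terms is unchanged. Both rank inequalities
  rest on this.\<close>

lemma has_rank_decomp_transport:
  fixes W :: "('a :: field, 'w) module" and W' :: "('a, 'z) module"
  assumes W: "vectorspace class_ring W" and W': "vectorspace class_ring W'"
    and T: "has_rank_decomp U V W T r"
    and f: "f \<in> LinearCombinations.module_hom class_ring U' U"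
    and g: "g \<in> LinearCombinations.module_hom class_ring V' V"
    and h: "h \<in> LinearCombinations.module_hom class_ring W W'"
  shows "has_rank_decomp U' V' W' (\<lambda>u v. h (T (f u) (g v))) r"
proof -
  interpret W: vectorspace class_ring W by (rule W)
  interpret W': vectorspace class_ring W' by (rule W')
  obtain \<alpha> \<beta> w where d: "\<forall>i<r. \<alpha> i \<in> dual_space U \<and> \<beta> i \<in> dual_space V \<and> w i \<in> carrier W"
    and e: "\<forall>u\<in>carrier U. \<forall>v\<in>carrier V. T u v = (\<Oplus>\<^bsub>W\<^esub>i\<in>{..<r}. (\<alpha> i u * \<beta> i v) \<odot>\<^bsub>W\<^esub> w i)"
    using T unfolding has_rank_decomp_def by blast
  have hw: "h (w i) \<in> carrier W'" if "i < r" for i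
    using LinearCombinations.module_hom_closed[OF h] d that by auto
  have "h (T (f u) (g v)) = (\<Oplus>\<^bsub>W'\<^esub>i\<in>{..<r}. (\<alpha> i (f u) * \<beta> i (g v)) \<odot>\<^bsub>W'\<^esub> h (w i))"
    if u: "u \<in> carrier U'" and v: "v \<in> carrier V'" for u v
  proof -
    have "f u \<in> carrier U" "g v \<in> carrier V"
      using LinearCombinations.module_hom_closed[OF f] LinearCombinations.module_hom_closed[OF g] u v
      by auto
    then have "h (T (f u) (g v)) = h (\<Oplus>\<^bsub>W\<^esub>i\<in>{..<r}. (\<alpha> i (f u) * \<beta> i (g v)) \<odot>\<^bsub>W\<^esub> w i)"
      using e by simp
    also have "\<dots> = (\<Oplus>\<^bsub>W'\<^esub>i\<in>{..<r}. h ((\<alpha> i (f u) * \<beta> i (g v)) \<odot>\<^bsub>W\<^esub> w i))"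
      using d by (intro linear_finsum[OF W W' h]) (auto intro!: W.smult_closed simp: class_ring_simps)
    also have "\<dots> = (\<Oplus>\<^bsub>W'\<^esub>i\<in>{..<r}. (\<alpha> i (f u) * \<beta> i (g v)) \<odot>\<^bsub>W'\<^esub> h (w i))"
      using d hw LinearCombinations.module_hom_smult[OF h]
      by (intro W'.finsum_cong') (auto intro!: W'.smult_closed simp: class_ring_simps)
    finally show ?thesis .
  qed
  moreover have "(\<lambda>u. \<alpha> i (f u)) \<in> dual_space U'" "(\<lambda>v. \<beta> i (g v)) \<in> dual_space V'" if "i < r" for i
    using d that linear_comp[OF f] linear_comp[OF g] unfolding dual_space_def by blast+
  ultimately show ?thesis
    unfolding has_rank_decomp_def using hw
    by (intro exI[of _ "\<lambda>i u. \<alpha> i (f u)"] exI[of _ "\<lambda>i v. \<beta> i (g v)"] exI[of _ "\<lambda>i. h (w i)"]) simp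
qed

text \<open>The factor \<open>c\<close> is the same for all \<open>n\<close>, so the two rank
  functions are big-O of each other and admit the same exponents \<tau>. The two infima are then
  taken over the same set.\<close>

lemma rank_exponent_eqI:
  assumes le: "\<And>n. tensor_rank (U n) (V n) (W n) (T n) \<le> c * tensor_rank (U' n) (V' n) (W' n) (T' n)"
    and ge: "\<And>n. tensor_rank (U' n) (V' n) (W' n) (T' n) \<le> tensor_rank (U n) (V n) (W n) (T n)"
  shows "rank_exponent U V W T = rank_exponent U' V' W' T'"
proof -
  let ?r = "\<lambda>n. real (tensor_rank (U n) (V n) (W n) (T n))"
  let ?r' = "\<lambda>n. real (tensor_rank (U' n) (V' n) (W' n) (T' n))"
  have "?r \<in> O(?r')"
    using le by (intro bigoI[of _ "real c"]) (auto simp flip: of_nat_mult)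
  moreover have "?r' \<in> O(?r)"
    using ge by (intro bigoI[of _ 1]) auto
  ultimately have "?r \<in> O(g) \<longleftrightarrow> ?r' \<in> O(g)" for g :: "nat \<Rightarrow> real"
    by (blast intro: landau_o.big_trans)
  then show ?thesis
    by (simp add: rank_exponent_def)
qed


section \<open>Matrix multiplication\<close>

lemma scalar_space_finsum: "finsum (scalar_space TYPE('a :: field)) f I = sum f I"
proof -
  interpret S: vectorspace class_ring "scalar_space TYPE('a)" by (rule scalar_space_vectorspace)
  have S: "add (scalar_space TYPE('a)) = (+)" "zero (scalar_space TYPE('a)) = 0"
    "carrier (scalar_space TYPE('a)) = UNIV"
    by (simp_all add: scalar_space_def)
  show ?thesis
  proof (induct I rule: infinite_finite_induct)
    case (insert x I)
    then show ?case using S.finsum_insert[of I x f] by (simp add: S)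
  qed (simp_all add: S)
qed

text \<open>Taking an entry of a matrix or tensor is a functional, so this turns an entry of an
  abstract \<open>finsum\<close> into an ordinary sum of entries.\<close>

lemma dual_space_finsum:
  fixes W :: "('a :: field, 'w) module"
  assumes "vectorspace class_ring W" "\<phi> \<in> dual_space W" "g \<in> I \<rightarrow> carrier W"
  shows "\<phi> (\<Oplus>\<^bsub>W\<^esub>i\<in>I. g i) = (\<Sum>i\<in>I. \<phi> (g i))"
  using linear_finsum[OF assms(1) scalar_space_vectorspace assms(2)[unfolded dual_space_def] assms(3)]
  by (simp add: scalar_space_finsum)

lemma mat_entry_dual:
  assumes "i < m" "j < n"
  shows "(\<lambda>A. A $$ (i, j)) \<in> dual_space (module_mat TYPE('a :: field) m n)"
  using assms unfolding dual_space_def LinearCombinations.module_hom_def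
  by (auto simp: scalar_space_def module_mat_simps)

lemma tensor3_entry_dual:
  assumes "i < m" "j < n" "k < p"
  shows "(\<lambda>A. A $ k $$ (i, j)) \<in> dual_space (tensor3_space TYPE('a :: field) m n p)"
proof -
  have "dim_row (A $ k) = m" "dim_col (A $ k) = n" if "A \<in> carrier_tensor3 m n p" for A :: "'a tensor3"
    using that assms by (auto simp: carrier_tensor3_def)
  then show ?thesis
    using assms unfolding dual_space_def LinearCombinations.module_hom_def
    by (auto simp: scalar_space_def tensor3_space_def)
qed

lemma finsum_mat_carrier:
  assumes "g \<in> I \<rightarrow> carrier_mat m n"
  shows "(\<Oplus>\<^bsub>module_mat TYPE('a :: field) m n\<^esub>k\<in>I. g k) \<in> carrier_mat m n"
proof -
  interpret W: vectorspace class_ring "module_mat TYPE('a) m n" by (rule matrix_vs)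
  show ?thesis using W.finsum_closed[of g I] assms by (simp add: module_mat_simps)
qed

lemma finsum_mat_index:
  assumes "g \<in> I \<rightarrow> carrier_mat m n" "i < m" "j < n"
  shows "(\<Oplus>\<^bsub>module_mat TYPE('a :: field) m n\<^esub>k\<in>I. g k) $$ (i, j) = (\<Sum>k\<in>I. g k $$ (i, j))"
  using assms by (intro dual_space_finsum[OF matrix_vs mat_entry_dual]) (auto simp: module_mat_simps)

text \<open>The schoolbook decomposition into \<open>n^3\<close> terms, with the matrix units
  \<open>E i j\<close> as vectors. It serves only to show that a decomposition exists. The form of
  the length mirrors three nested uses of \<open>has_rank_decomp_finsum\<close> over rank-one
  maps.\<close>

lemma mat_mult_has_rank_decomp:
  fixes n :: nat
  defines "W \<equiv> module_mat TYPE('a :: field) n n"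
  shows "has_rank_decomp W W W (\<lambda>A B. A * B) (n * (n * (n * 1)))"
proof -
  define E :: "nat \<Rightarrow> nat \<Rightarrow> 'a mat" where "E i j = mat n n (\<lambda>ij. if ij = (i, j) then 1 else 0)" for i j
  have W: "vectorspace class_ring W" unfolding W_def by (rule matrix_vs)
  have c: "carrier W = carrier_mat n n" and s: "module.smult W = (\<cdot>\<^sub>m)"
    by (simp_all add: W_def module_mat_simps)
  have E: "E i j \<in> carrier_mat n n" for i j by (simp add: E_def)
  have "has_rank_decomp W W W (\<lambda>A B. \<Oplus>\<^bsub>W\<^esub>i\<in>{..<n}. \<Oplus>\<^bsub>W\<^esub>j\<in>{..<n}. \<Oplus>\<^bsub>W\<^esub>k\<in>{..<n}.
      (A $$ (i, k) * B $$ (k, j)) \<odot>\<^bsub>W\<^esub> E i j) (n * (n * (n * 1)))"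
    by (intro has_rank_decomp_finsum[OF W] has_rank_decomp_simple[OF W])
      (auto simp: c E intro!: mat_entry_dual[where 'a = 'a and m = n and n = n, folded W_def])
  then show ?thesis
  proof (rule has_rank_decomp_cong)
    fix A B assume "A \<in> carrier W" "B \<in> carrier W"
    then have AB: "A \<in> carrier_mat n n" "B \<in> carrier_mat n n" by (simp_all add: c)
    let ?t = "\<lambda>i' j' k. (A $$ (i', k) * B $$ (k, j')) \<odot>\<^bsub>W\<^esub> E i' j'"
    have t: "?t i' j' \<in> {..<n} \<rightarrow> carrier_mat n n" for i' j'
      using E by (simp add: s)
    note t2 = finsum_mat_carrier[OF t, folded W_def]
    have t2': "(\<lambda>j'. \<Oplus>\<^bsub>W\<^esub>k\<in>{..<n}. ?t i' j' k) \<in> {..<n} \<rightarrow> carrier_mat n n" for i'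
      using t2 by blast
    note t3 = finsum_mat_carrier[OF t2', folded W_def]
    have t3': "(\<lambda>i'. \<Oplus>\<^bsub>W\<^esub>j'\<in>{..<n}. \<Oplus>\<^bsub>W\<^esub>k\<in>{..<n}. ?t i' j' k) \<in> {..<n} \<rightarrow> carrier_mat n n"
      using t3 by blast
    show "A * B = (\<Oplus>\<^bsub>W\<^esub>i'\<in>{..<n}. \<Oplus>\<^bsub>W\<^esub>j'\<in>{..<n}. \<Oplus>\<^bsub>W\<^esub>k\<in>{..<n}. ?t i' j' k)" (is "_ = ?S")
    proof (rule eq_matI)
      have S: "?S \<in> carrier_mat n n"
        by (rule finsum_mat_carrier[OF t3', folded W_def])
      then show "dim_row (A * B) = dim_row ?S" "dim_col (A * B) = dim_col ?S" using AB by auto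
      fix i j assume "i < dim_row ?S" "j < dim_col ?S"
      then have ij: "i < n" "j < n" using S by auto
      have "?S $$ (i, j) = (\<Sum>i'<n. \<Sum>j'<n. \<Sum>k<n. ?t i' j' k $$ (i, j))"
        by (simp only: finsum_mat_index[OF t3' ij, folded W_def] finsum_mat_index[OF t2' ij, folded W_def]
            finsum_mat_index[OF t ij, folded W_def])
      also have "\<dots> = (\<Sum>i'<n. \<Sum>j'<n. if i' = i \<and> j' = j then \<Sum>k<n. A $$ (i', k) * B $$ (k, j') else 0)"
        using ij by (intro sum.cong refl) (auto simp: E_def s)
      \<comment> \<open>The joint condition is separated into nested ones so that each outer sum
        collapses by \<open>sum.delta\<close>.\<close>
      also have "\<dots> = (\<Sum>i'<n. if i' = i then \<Sum>j'<n. if j' = j then \<Sum>k<n. A $$ (i', k) * B $$ (k, j') else 0 else 0)"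
        by (intro sum.cong refl) auto
      also have "\<dots> = (\<Sum>k<n. A $$ (i, k) * B $$ (k, j))"
        using ij by (simp add: sum.delta)
      also have "\<dots> = (A * B) $$ (i, j)"
        using AB ij by (simp add: scalar_prod_def lessThan_atLeast0)
      finally show "(A * B) $$ (i, j) = ?S $$ (i, j)" ..
    qed
  qed
qed


section \<open>The Moore-Penrose inverse of a matrix of full row rank\<close>

lemma mat_adjoint_index:
  "i < dim_col A \<Longrightarrow> j < dim_row A \<Longrightarrow> mat_adjoint A $$ (i, j) = conjugate (A $$ (j, i))"
  by (simp add: mat_adjoint_def mat_of_rows_index)

lemma mat_adjoint_carrier: "A \<in> carrier_mat m n \<Longrightarrow> mat_adjoint A \<in> carrier_mat n m"
  by (auto simp: mat_adjoint_def)

text \<open>A maximal independent set of columns has \<open>q\<close> elements and is thus a basis.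
  The vectors annihilated by \<open>v\<close> form a subspace containing this basis, hence
  everything; testing with unit vectors gives \<open>v = 0\<close>. The product here is bilinear,
  without conjugation.\<close>

lemma full_row_rank_orthogonal_cols:
  fixes M :: "'a :: field mat"
  assumes M: "M \<in> carrier_mat q p" and rank: "vec_space.rank q M = q"
    and v: "v \<in> carrier_vec q" and orth: "\<And>j. j < p \<Longrightarrow> v \<bullet> col M j = 0"
  shows "v = 0\<^sub>v q"
proof -
  interpret vec_space "TYPE('a)" q .
  have sub: "set (cols M) \<subseteq> carrier_vec q"
    using M cols_dim by blast
  obtain S where S: "maximal S (\<lambda>T. T \<subseteq> set (cols M) \<and> lin_indpt T)"
    using maximal_exists_superset[of "set (cols M)" "\<lambda>T. T \<subseteq> set (cols M) \<and> lin_indpt T" "{}"]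
    by (auto simp: lin_dep_def)
  then have "card S = q" and SM: "S \<subseteq> set (cols M)" and li: "lin_indpt S"
    using rank_card_indpt[OF M S] rank by (auto simp: maximal_def)
  then have "basis S"
    using sub finite_subset[OF SM] by (intro dim_li_is_basis fin_dim) (auto simp: dim_is_n)
  then have span: "span S = carrier_vec q"
    by (simp add: basis_def)
  have zero: "v \<bullet> s = 0" if "s \<in> S" for s
    using that SM orth M by (auto simp: cols_def)
  have "submodule class_ring {u \<in> carrier_vec q. v \<bullet> u = 0} V"
    using v by (unfold_locales) (auto simp: class_ring_simps module_vec_simps scalar_prod_add_distrib)
  then have "span S \<subseteq> {u \<in> carrier_vec q. v \<bullet> u = 0}"
    using zero SM sub by (intro span_is_subset) auto
  then have orth_all: "v \<bullet> u = 0" if "u \<in> carrier_vec q" for u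
    using that unfolding span by blast
  show ?thesis
  proof (rule eq_vecI)
    fix i assume "i < dim_vec (0\<^sub>v q)"
    then show "v $ i = 0\<^sub>v q $ i"
      using v orth_all[of "unit_vec q i"] by (simp add: scalar_prod_right_unit)
  qed (use v in auto)
qed

text \<open>Full row rank makes the Gram matrix \<open>M M\<^sup>H\<close> invertible, so
  \<open>mat_inverse\<close> returns a \<open>Some\<close> and \<open>pinv M\<close> has its
  intended value. The ordered field class supplies definiteness: \<open>w \<bullet>c w = 0\<close>
  forces \<open>w = 0\<close>.\<close>

lemma mult_pinv:
  fixes M :: "'a :: conjugatable_ordered_field mat"
  assumes M: "M \<in> carrier_mat q p" and rank: "vec_space.rank q M = q"
  shows "pinv M \<in> carrier_mat p q" and "M * pinv M = 1\<^sub>m q"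
proof -
  let ?G = "M * mat_adjoint M"
  note [simp] = mat_adjoint_carrier[OF M]
  have G: "?G \<in> carrier_mat q q" using M by auto
  have "det ?G \<noteq> 0"
  proof
    assume "det ?G = 0"
    then obtain v where v: "v \<in> carrier_vec q" "v \<noteq> 0\<^sub>v q" and Gv: "?G *\<^sub>v v = 0\<^sub>v q"
      using det_0_iff_vec_prod_zero_field[OF G] by blast
    define w where "w = mat_adjoint M *\<^sub>v v"
    have w: "w \<in> carrier_vec p" unfolding w_def using M v by (meson mat_adjoint_carrier mult_mat_vec_carrier)
    \<comment> \<open>Conjugating \<open>w = M\<^sup>H v\<close> leaves the columns of
      \<open>M\<close> unconjugated, which is the form that
      \<open>full_row_rank_orthogonal_cols\<close> expects, applied to
      \<open>conjugate v\<close>.\<close>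
    have cw: "conjugate w $ j = conjugate v \<bullet> col M j" if "j < p" for j
      using that M v by (auto simp: w_def scalar_prod_def mat_adjoint_index sum_conjugate conjugate_dist_mul
          mat_adjoint_carrier[OF M, THEN carrier_matD(1)] mat_adjoint_carrier[OF M, THEN carrier_matD(2)] mult.commute intro!: sum.cong)
    \<comment> \<open>\<open>M M\<^sup>H v = 0\<close> gives \<open>\<parallel>M\<^sup>H v\<parallel>\<^sup>2 = v\<^sup>H M M\<^sup>H v = 0\<close>, so \<open>v\<close> is orthogonal to the columns of \<open>M\<close>.\<close>
    have Mw: "M *\<^sub>v w = 0\<^sub>v q"
      using Gv M v unfolding w_def by (simp add: assoc_mult_mat_vec[OF M mat_adjoint_carrier[OF M]])
    have "w \<bullet>c w = (\<Sum>j<p. w $ j * (\<Sum>i<q. conjugate (v $ i) * M $$ (i, j)))"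
      using w v M by (simp add: scalar_prod_def cw lessThan_atLeast0 del: vec_index_conjugate)
        (simp add: v(1)[THEN carrier_vecD])
    also have "\<dots> = (\<Sum>i<q. conjugate (v $ i) * (\<Sum>j<p. M $$ (i, j) * w $ j))"
      unfolding sum_distrib_left by (subst sum.swap) (simp add: ac_simps)
    also have "\<dots> = (\<Sum>i<q. conjugate (v $ i) * (M *\<^sub>v w) $ i)"
      using M w by (simp add: scalar_prod_def lessThan_atLeast0)
    also have "\<dots> = 0" using Mw by simp
    finally have "w = 0\<^sub>v p" using w by simp
    then have "conjugate v \<bullet> col M j = 0" if "j < p" for j
      using cw[OF that] that by simp
    then have "conjugate v = 0\<^sub>v q"
      using v by (intro full_row_rank_orthogonal_cols[OF M rank]) auto
    then show False using v by simp
  qed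
  then have "?G \<in> Units (ring_mat TYPE('a) q ())"
    by (rule det_non_zero_imp_unit[OF G])
  then obtain B where B: "mat_inverse ?G = Some B"
    using mat_inverse(1)[OF G, of "()"] by (cases "mat_inverse ?G") auto
  note B' = mat_inverse(2)[OF G B]
  show "pinv M \<in> carrier_mat p q"
    unfolding pinv_def using B B' by (auto intro: mult_carrier_mat[OF mat_adjoint_carrier[OF M]])
  show "M * pinv M = 1\<^sub>m q"
    using assoc_mult_mat[OF M mat_adjoint_carrier[OF M], of B q] B' unfolding pinv_def B option.sel
    by metis
qed


section \<open>Slices and embeddings\<close>

text \<open>The map \<open>f\<^sub>k\<close> of the overview, with the tensor as last argument so
  that the partial application is the linear map.\<close>

definition tensor_slice :: "nat \<Rightarrow> nat \<Rightarrow> 'a :: field mat \<Rightarrow> nat \<Rightarrow> 'a tensor3 \<Rightarrow> 'a mat" where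
  "tensor_slice m n M k A = mode3_prod m n A M $ k"

text \<open>The map \<open>h\<^sub>k\<close> of the overview when \<open>P\<close> is
  \<open>pinv M\<close>, in closed form: a mode-3 product of a tensor with one nonzero slice only
  sees column \<open>k\<close> of \<open>P\<close>.\<close>

definition tensor_embed :: "'a :: field mat \<Rightarrow> nat \<Rightarrow> 'a mat \<Rightarrow> 'a tensor3" where
  "tensor_embed P k C = vec (dim_row P) (\<lambda>l. P $$ (l, k) \<cdot>\<^sub>m C)"

lemma tensor_slice_linear:
  assumes "M \<in> carrier_mat q p" "k < q"
  shows "tensor_slice m n M k \<in> LinearCombinations.module_hom class_ring
    (tensor3_space TYPE('a :: field) m n p) (module_mat TYPE('a) m n)"
proof -
  have d: "dim_row (A $ l) = m" "dim_col (A $ l) = n" if "A \<in> carrier_tensor3 m n p" "l < p"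
    for A :: "'a tensor3" and l
    using that assms by (auto simp: carrier_tensor3_def)
  have "tensor_slice m n M k (vec p (\<lambda>l. A $ l + B $ l)) = tensor_slice m n M k A + tensor_slice m n M k B"
    if "A \<in> carrier_tensor3 m n p" "B \<in> carrier_tensor3 m n p" for A B
    using assms that
    by (intro eq_matI) (simp_all add: tensor_slice_def mode3_prod_def d distrib_left sum.distrib)
  moreover have "tensor_slice m n M k (vec p (\<lambda>l. c \<cdot>\<^sub>m A $ l)) = c \<cdot>\<^sub>m tensor_slice m n M k A"
    if "A \<in> carrier_tensor3 m n p" for A c
    using assms that
    by (intro eq_matI) (simp_all add: tensor_slice_def mode3_prod_def d sum_distrib_left mult.left_commute)
  moreover have "tensor_slice m n M k A \<in> carrier_mat m n" for A
    using assms by (simp add: tensor_slice_def mode3_prod_def)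
  ultimately show ?thesis
    by (simp add: LinearCombinations.module_hom_def tensor3_space_def module_mat_simps)
qed

lemma tensor_embed_linear:
  assumes "P \<in> carrier_mat p q"
  shows "tensor_embed P k \<in> LinearCombinations.module_hom class_ring
    (module_mat TYPE('a :: field) m n) (tensor3_space TYPE('a) m n p)"
proof -
  have "tensor_embed P k (A + B) = vec p (\<lambda>l. tensor_embed P k A $ l + tensor_embed P k B $ l)"
    if "A \<in> carrier_mat m n" "B \<in> carrier_mat m n" for A B
    using assms that by (intro eq_vecI) (simp_all add: tensor_embed_def add_smult_distrib_left_mat)
  moreover have "tensor_embed P k (c \<cdot>\<^sub>m A) = vec p (\<lambda>l. c \<cdot>\<^sub>m tensor_embed P k A $ l)" for A c
    using assms by (intro eq_vecI) (auto simp: tensor_embed_def mult.left_commute intro!: eq_matI)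
  moreover have "tensor_embed P k A \<in> carrier_tensor3 m n p" if "A \<in> carrier_mat m n" for A
    using assms that by (simp add: tensor_embed_def carrier_tensor3_def)
  ultimately show ?thesis
    by (simp add: LinearCombinations.module_hom_def tensor3_space_def module_mat_simps)
qed

text \<open>The slice is \<open>C\<close> scaled by the sum over \<open>l\<close> of
  \<open>M $$ (k, l) * P $$ (l, k')\<close>, which is an entry of \<open>M * P\<close> and hence a
  Kronecker delta.\<close>

lemma tensor_slice_embed:
  fixes M P :: "'a :: field mat"
  assumes M: "M \<in> carrier_mat q p" and P: "P \<in> carrier_mat p q" and MP: "M * P = 1\<^sub>m q"
    and k: "k < q" "k' < q" and C: "C \<in> carrier_mat m n"
  shows "tensor_slice m n M k (tensor_embed P k' C) = (if k = k' then C else 0\<^sub>m m n)"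
proof -
  have "(\<Sum>l<p. M $$ (k, l) * P $$ (l, k')) = (M * P) $$ (k, k')"
    using M P k by (simp add: scalar_prod_def lessThan_atLeast0)
  then have *: "(\<Sum>l<p. M $$ (k, l) * P $$ (l, k')) = (if k = k' then 1 else 0)"
    using k by (simp add: MP)
  have "(\<Sum>l<p. M $$ (k, l) * (P $$ (l, k') * c)) = (if k = k' then c else 0)" for c
    unfolding mult.assoc[symmetric] sum_distrib_right[symmetric] * by simp
  then show ?thesis
    using assms by (auto simp: tensor_slice_def tensor_embed_def mode3_prod_def intro!: eq_matI)
qed

section \<open>The tensor product as a sum of matrix products, and the comparison of ranks\<close>

text \<open>Expanding the outer mode-3 product with \<open>pinv M\<close> gives one summand per
  face. The equation holds for all \<open>A\<close> and \<open>B\<close>, because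
  \<open>mode3_prod\<close> fixes the format of its slices, so it can be unfolded as an equation
  between functions.\<close>

lemma tensor_mult_eq_finsum:
  fixes M :: "'a :: conjugatable_field mat"
  assumes M: "M \<in> carrier_mat q p" and P: "pinv M \<in> carrier_mat p q"
  shows "tensor_mult m s n M A B = (\<Oplus>\<^bsub>tensor3_space TYPE('a) m n p\<^esub>k\<in>{..<q}.
    tensor_embed (pinv M) k (tensor_slice m s M k A * tensor_slice s n M k B))"
    (is "_ = (\<Oplus>\<^bsub>?W\<^esub>k\<in>_. ?t k)")
proof -
  let ?C = "\<lambda>k. tensor_slice m s M k A * tensor_slice s n M k B"
  interpret W: vectorspace class_ring ?W by (rule tensor3_space_vectorspace)
  have C: "?C k \<in> carrier_mat m n" if "k < q" for k
    using that M by (auto simp: tensor_slice_def mode3_prod_def)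
  have t: "?t \<in> {..<q} \<rightarrow> carrier ?W"
    using LinearCombinations.module_hom_closed[OF tensor_embed_linear[OF P]] C
    by (fastforce simp: module_mat_simps Pi_iff)
  then have S: "(\<Oplus>\<^bsub>?W\<^esub>k\<in>{..<q}. ?t k) \<in> carrier_tensor3 m n p"
    using W.finsum_closed[OF t] by (simp add: tensor3_space_def)
  show ?thesis
  proof (rule eq_vecI)
    show "dim_vec (tensor_mult m s n M A B) = dim_vec (\<Oplus>\<^bsub>?W\<^esub>k\<in>{..<q}. ?t k)"
      using tensor_mult_carrier[of m s n M A B] S M by (simp add: carrier_tensor3_def)
    fix l assume "l < dim_vec (\<Oplus>\<^bsub>?W\<^esub>k\<in>{..<q}. ?t k)"
    then have l: "l < p" and Sl: "(\<Oplus>\<^bsub>?W\<^esub>k\<in>{..<q}. ?t k) $ l \<in> carrier_mat m n"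
      using S by (auto simp: carrier_tensor3_def)
    have Tl: "tensor_mult m s n M A B $ l \<in> carrier_mat m n"
      using tensor_mult_carrier[of m s n M A B] M l by (simp add: carrier_tensor3_def)
    show "tensor_mult m s n M A B $ l = (\<Oplus>\<^bsub>?W\<^esub>k\<in>{..<q}. ?t k) $ l"
    proof (rule eq_matI)
      fix i j assume "i < dim_row ((\<Oplus>\<^bsub>?W\<^esub>k\<in>{..<q}. ?t k) $ l)" "j < dim_col ((\<Oplus>\<^bsub>?W\<^esub>k\<in>{..<q}. ?t k) $ l)"
      then have ij: "i < m" "j < n" using Sl by auto
      have "(\<Oplus>\<^bsub>?W\<^esub>k\<in>{..<q}. ?t k) $ l $$ (i, j) = (\<Sum>k<q. ?t k $ l $$ (i, j))"
        by (rule dual_space_finsum[OF tensor3_space_vectorspace tensor3_entry_dual[OF ij l] t])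
      also have "\<dots> = (\<Sum>k<q. pinv M $$ (l, k) * ?C k $$ (i, j))"
      proof (intro sum.cong refl)
        fix k assume "k \<in> {..<q}"
        then have "dim_row (?C k) = m" "dim_col (?C k) = n"
          using C[of k] by (auto simp del: index_mult_mat)
        then show "?t k $ l $$ (i, j) = pinv M $$ (l, k) * ?C k $$ (i, j)"
          using P l ij by (simp add: tensor_embed_def del: index_mult_mat(1))
      qed
      also have "\<dots> = tensor_mult m s n M A B $ l $$ (i, j)"
        using M P l ij by (simp add: tensor_mult_def mode3_prod_def facewise_prod_def tensor_slice_def)
      finally show "tensor_mult m s n M A B $ l $$ (i, j) = (\<Oplus>\<^bsub>?W\<^esub>k\<in>{..<q}. ?t k) $ l $$ (i, j)" ..
    qed (use Sl Tl in auto)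
  qed
qed

text \<open>The class \<open>conjugatable_ordered_field\<close> covers the real and the complex case
  at once. The constant for \<open>rank_exponent_eqI\<close> is \<open>q\<close>, which does not
  depend on \<open>n\<close>.\<close>

lemma rank_exponent_tensor_mult:
  fixes M :: "'a :: conjugatable_ordered_field mat"
  assumes M: "M \<in> carrier_mat q p" and rank: "vec_space.rank q M = q" and q: "1 \<le> q"
  shows "rank_exponent
      (\<lambda>n. tensor3_space TYPE('a) n n p) (\<lambda>n. tensor3_space TYPE('a) n n p)
      (\<lambda>n. tensor3_space TYPE('a) n n p) (\<lambda>n. tensor_mult n n n M) =
    rank_exponent
      (\<lambda>n. module_mat TYPE('a) n n) (\<lambda>n. module_mat TYPE('a) n n)
      (\<lambda>n. module_mat TYPE('a) n n) (\<lambda>n A B. A * B)"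
proof (rule rank_exponent_eqI)
  note P = mult_pinv[OF M rank]
  fix n :: nat
  let ?X = "tensor3_space TYPE('a) n n p" and ?Y = "module_mat TYPE('a) n n"
  note X = tensor3_space_vectorspace[where 'a = 'a, of n n p]
  note Y = matrix_vs[where 'a = 'a, of n n]
  note slice = tensor_slice_linear[OF M, of _ n n]
  note embed = tensor_embed_linear[OF P(1), of _ n n]
  \<comment> \<open>Each of the \<open>q\<close> summands is a linear image of the matrix product
    and so has a decomposition of length \<open>r\<close>.\<close>
  have upper: "has_rank_decomp ?X ?X ?X (tensor_mult n n n M) (q * r)"
    if r: "has_rank_decomp ?Y ?Y ?Y (\<lambda>A B. A * B) r" for r
    unfolding tensor_mult_eq_finsum[OF M P(1), abs_def]
    by (intro has_rank_decomp_finsum[OF X] has_rank_decomp_transport[OF Y X r slice slice embed]) auto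
  have lower: "has_rank_decomp ?Y ?Y ?Y (\<lambda>A B. A * B) r"
    if r: "has_rank_decomp ?X ?X ?X (tensor_mult n n n M) r" for r
  proof -
    \<comment> \<open>Since \<open>q\<close> is positive, position 0 exists and can host the matrix
      product.\<close>
    have 0: "0 < q" using q by simp
    have "has_rank_decomp ?Y ?Y ?Y (\<lambda>A B. tensor_slice n n M 0
        (tensor_mult n n n M (tensor_embed (pinv M) 0 A) (tensor_embed (pinv M) 0 B))) r"
      by (rule has_rank_decomp_transport[OF X Y r embed embed slice[OF 0]])
    then show ?thesis
    proof (rule has_rank_decomp_cong)
      fix A B assume "A \<in> carrier ?Y" "B \<in> carrier ?Y"
      then have A: "A \<in> carrier_mat n n" and B: "B \<in> carrier_mat n n"
        by (simp_all add: module_mat_simps)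
      let ?t = "\<lambda>k. tensor_embed (pinv M) k (tensor_slice n n M k (tensor_embed (pinv M) 0 A)
        * tensor_slice n n M k (tensor_embed (pinv M) 0 B))"
      note se = tensor_slice_embed[OF M P _ _]
      \<comment> \<open>Both factors are embedded at position 0, so every other face multiplies zero
        matrices.\<close>
      have t: "?t k = tensor_embed (pinv M) k (if k = 0 then A * B else 0\<^sub>m n n)" if "k < q" for k
        using that 0 A B by (simp add: se)
      have tc: "?t \<in> {..<q} \<rightarrow> carrier ?X"
      proof
        fix k assume "k \<in> {..<q}"
        then show "?t k \<in> carrier ?X"
          using LinearCombinations.module_hom_closed[OF embed, of k]
          by (simp only: t lessThan_iff) (rule PiE, assumption, use A B in \<open>auto simp: module_mat_simps\<close>)
      qed
      have AB: "A * B \<in> carrier_mat n n" using A B by simp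
      \<comment> \<open>For \<open>k = 0\<close> the slice undoes the embedding; for other
        \<open>k\<close> the positions differ and the slice vanishes.\<close>
      have st: "tensor_slice n n M 0 (?t k) = (if k = 0 then A * B else 0\<^sub>m n n)" if "k < q" for k
        using that 0 AB by (simp add: t se)
      have "tensor_slice n n M 0 (\<Oplus>\<^bsub>?X\<^esub>k\<in>{..<q}. ?t k) = (\<Oplus>\<^bsub>?Y\<^esub>k\<in>{..<q}. tensor_slice n n M 0 (?t k))"
        by (rule linear_finsum[OF X Y slice[OF 0] tc])
      also have "\<dots> = A * B"
      proof (rule eq_matI)
        let ?S = "\<Oplus>\<^bsub>?Y\<^esub>k\<in>{..<q}. tensor_slice n n M 0 (?t k)"
        have c: "(\<lambda>k. tensor_slice n n M 0 (?t k)) \<in> {..<q} \<rightarrow> carrier_mat n n"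
          using AB by (auto simp: st)
        show "dim_row ?S = dim_row (A * B)" "dim_col ?S = dim_col (A * B)"
          using finsum_mat_carrier[OF c] AB by auto
        fix i j assume "i < dim_row (A * B)" "j < dim_col (A * B)"
        then have ij: "i < n" "j < n" using AB by auto
        have "?S $$ (i, j) = (\<Sum>k<q. if k = 0 then (A * B) $$ (i, j) else 0)"
          unfolding finsum_mat_index[OF c ij] using ij by (intro sum.cong refl) (simp add: st)
        then show "?S $$ (i, j) = (A * B) $$ (i, j)"
          using 0 by simp
      qed
      finally show "A * B = tensor_slice n n M 0
        (tensor_mult n n n M (tensor_embed (pinv M) 0 A) (tensor_embed (pinv M) 0 B))"
        unfolding tensor_mult_eq_finsum[OF M P(1)] ..
    qed
  qed
  \<comment> \<open>The schoolbook decomposition shows that the matrix rank is attained. Through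
    \<open>upper\<close> it also provides a decomposition of the tensor product, so that rank is
    attained too and \<open>lower\<close> applies to it.\<close>
  note Y_rank = has_rank_decomp_tensor_rank[OF mat_mult_has_rank_decomp[where 'a = 'a, of n]]
  show "tensor_rank ?X ?X ?X (tensor_mult n n n M) \<le> q * tensor_rank ?Y ?Y ?Y (\<lambda>A B. A * B)"
    by (rule tensor_rank_le[OF upper[OF Y_rank]])
  show "tensor_rank ?Y ?Y ?Y (\<lambda>A B. A * B) \<le> tensor_rank ?X ?X ?X (tensor_mult n n n M)"
    by (rule tensor_rank_le[OF lower[OF has_rank_decomp_tensor_rank[OF upper[OF Y_rank]]]])
qed

theorem theorem3p1:
  fixes p q :: nat
  assumes "1 \<le> q" and "q \<le> p"
  shows "(\<forall>M :: real mat. M \<in> carrier_mat q p \<and> vec_space.rank q M = q \<longrightarrow>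
            rank_exponent
              (\<lambda>n. tensor3_space TYPE(real) n n p) (\<lambda>n. tensor3_space TYPE(real) n n p)
              (\<lambda>n. tensor3_space TYPE(real) n n p) (\<lambda>n. tensor_mult n n n M) =
            rank_exponent
              (\<lambda>n. module_mat TYPE(real) n n) (\<lambda>n. module_mat TYPE(real) n n)
              (\<lambda>n. module_mat TYPE(real) n n) (\<lambda>n A B. A * B))
       \<and> (\<forall>M :: complex mat. M \<in> carrier_mat q p \<and> vec_space.rank q M = q \<longrightarrow>
            rank_exponent
              (\<lambda>n. tensor3_space TYPE(complex) n n p) (\<lambda>n. tensor3_space TYPE(complex) n n p)
              (\<lambda>n. tensor3_space TYPE(complex) n n p) (\<lambda>n. tensor_mult n n n M) =
            rank_exponent
              (\<lambda>n. module_mat TYPE(complex) n n) (\<lambda>n. module_mat TYPE(complex) n n)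
              (\<lambda>n. module_mat TYPE(complex) n n) (\<lambda>n A B. A * B))"
  by (intro conjI allI impI; elim conjE; rule rank_exponent_tensor_mult[OF _ _ assms(1)])

end
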